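(* Let $n\equiv0\pmod4$, $n\ge4$, and put $m=n/2$. View $n\times n$ complex matrices as $m\times m$ matrices of $2\times2$ blocks, writing $X_{(p,q)}$ for the block in block-row $p$ and block-column $q$ ($1\le p,q\le m$). The solutions $X\in M_n(\mathbb{C})$ of $X^tA_n^2+A_n^2X=0$ are exactly the matrices of the following form, for arbitrary $Z_0,Z_1,\dots,Z_{(n-4)/4}\in M_2(\mathbb{C})$: - $X_{(p,q)}=Z_{(q-p)/2}$ for $p,q$ both odd and $p\le q$; - $X_{(p,q)}=-Z_{(p-q)/2}^t$ for $p,q$ both even and $p\ge q$; - $X_{(p,q)}=0$ in all other cases.
   Context: $A_n$ is the $n\times n$ matrix with $(A_n)_{i,i+1}=1$ for $1\le i\le n-1$ and zeros elsewhere; $A_n^2$ is its square, so $(A_n^2)_{i,i+2}=1$ for $1\le i\le n-2$ and all other entries are $0$. *)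

theory Defs
  imports Complex_Main "Jordan_Normal_Form.Matrix"
begin

text \<open>The entries of a matrix are indexed from 0, so the condition \<open>j = i + 1\<close> describes the
  same superdiagonal as in 1-based indexing.\<close>

definition shift_mat :: "nat \<Rightarrow> complex mat" where
  "shift_mat n = mat n n (\<lambda>(i, j). if j = i + 1 then 1 else 0)"

text \<open>Block indices \<open>p\<close>, \<open>q\<close> start at 1: block \<open>(p, q)\<close> occupies the 0-based rows
  \<open>2 (p - 1)\<close>, \<open>2 (p - 1) + 1\<close> and columns \<open>2 (q - 1)\<close>, \<open>2 (q - 1) + 1\<close>.\<close>

definition block2 :: "'a mat \<Rightarrow> nat \<Rightarrow> nat \<Rightarrow> 'a mat" where
  "block2 X p q = mat 2 2 (\<lambda>(i, j). X $$ (2 * (p - 1) + i, 2 * (q - 1) + j))"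

end

theory Submission
  imports Defs
begin

text \<open>Write \<open>Y P Q\<close> for the blocks of \<open>X\<close>, indexed from 0. Multiplication by the square of the shift
  moves whole blocks, so the equation says that \<open>Y (P + 1) Q = - (Y (Q - 1) P)\<^sup>t\<close>, where a block outside
  the matrix counts as 0. Applying this twice shows that \<open>Y\<close> is constant along diagonals in
  steps of 2. A diagonal of the wrong parity or on the wrong side then runs into a zero block
  in block-column 0 or in the last block-column.\<close>

section \<open>Entries of the products with the square of the shift\<close>

lemma dim_shift_mat [simp]: "dim_row (shift_mat n) = n" "dim_col (shift_mat n) = n"
  by (simp_all add: shift_mat_def)

lemma shift_mat_square:
  "shift_mat n ^\<^sub>m 2 = mat n n (\<lambda>(i, j). if j = i + 2 then 1 else 0)"
proof (rule eq_matI)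
  fix i j assume "i < dim_row (mat n n (\<lambda>(i, j). if j = i + 2 then 1 else (0::complex)))"
    and "j < dim_col (mat n n (\<lambda>(i, j). if j = i + 2 then 1 else (0::complex)))"
  then have ij: "i < n" "j < n" by auto
  have "(shift_mat n ^\<^sub>m 2) $$ (i, j)
      = (\<Sum>k = 0..<n. shift_mat n $$ (i, k) * shift_mat n $$ (k, j))"
    using ij by (simp add: numeral_2_eq_2 scalar_prod_def)
  also have "\<dots> = (\<Sum>k = 0..<n. if k = i + 1 then (if j = i + 2 then 1 else 0) else 0)"
    using ij by (intro sum.cong) (auto simp: shift_mat_def)
  also have "\<dots> = (if j = i + 2 then 1 else 0)"
    using ij by simp
  finally show "(shift_mat n ^\<^sub>m 2) $$ (i, j) = mat n n (\<lambda>(i, j). if j = i + 2 then 1 else 0) $$ (i, j)"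
    using ij by simp
qed (simp_all add: numeral_2_eq_2)

lemma index_transpose_mult_shift_square:
  assumes "X \<in> carrier_mat n n" "i < n" "j < n"
  shows "(transpose_mat X * (shift_mat n ^\<^sub>m 2)) $$ (i, j) = (if 2 \<le> j then X $$ (j - 2, i) else 0)"
proof -
  have "(transpose_mat X * (shift_mat n ^\<^sub>m 2)) $$ (i, j)
      = (\<Sum>k = 0..<n. X $$ (k, i) * (if j = k + 2 then 1 else 0))"
    using assms by (simp add: shift_mat_square scalar_prod_def)
  \<comment> \<open>The guard is there because \<open>j - 2\<close> truncates: for
    \<open>j < 2\<close> no \<open>k\<close> satisfies \<open>j = k + 2\<close>, but
    \<open>k = 0\<close> satisfies \<open>k = j - 2\<close>.\<close>
  also have "\<dots> = (\<Sum>k = 0..<n. if k = j - 2 then (if 2 \<le> j then X $$ (k, i) else 0) else 0)"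
    by (intro sum.cong) auto
  also have "\<dots> = (if 2 \<le> j then X $$ (j - 2, i) else 0)"
    using assms by auto
  finally show ?thesis .
qed

lemma index_shift_square_mult:
  assumes "X \<in> carrier_mat n n" "i < n" "j < n"
  shows "((shift_mat n ^\<^sub>m 2) * X) $$ (i, j) = (if i + 2 < n then X $$ (i + 2, j) else 0)"
proof -
  have "((shift_mat n ^\<^sub>m 2) * X) $$ (i, j)
      = (\<Sum>k = 0..<n. (if k = i + 2 then 1 else 0) * X $$ (k, j))"
    using assms by (simp add: shift_mat_square scalar_prod_def)
  also have "\<dots> = (\<Sum>k = 0..<n. if k = i + 2 then X $$ (k, j) else 0)"
    by (intro sum.cong) auto
  also have "\<dots> = (if i + 2 < n then X $$ (i + 2, j) else 0)"
    by simp
  finally show ?thesis .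
qed

lemma shift_square_equation_iff:
  assumes X: "X \<in> carrier_mat n n"
  shows "transpose_mat X * (shift_mat n ^\<^sub>m 2) + (shift_mat n ^\<^sub>m 2) * X = 0\<^sub>m n n \<longleftrightarrow>
    (\<forall>i < n. \<forall>j < n. (if 2 \<le> j then X $$ (j - 2, i) else 0)
       + (if i + 2 < n then X $$ (i + 2, j) else 0) = 0)"
    (is "?S = _ \<longleftrightarrow> (\<forall>i < n. \<forall>j < n. ?e i j = 0)")
proof -
  have dims: "dim_row ?S = n" "dim_col ?S = n"
    using X by (simp_all add: shift_mat_square)
  have "?S $$ (i, j) = ?e i j" if "i < n" "j < n" for i j
  proof -
    have "?S $$ (i, j) = (transpose_mat X * (shift_mat n ^\<^sub>m 2)) $$ (i, j)
        + ((shift_mat n ^\<^sub>m 2) * X) $$ (i, j)"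
      using X that by (subst index_add_mat) (simp_all add: shift_mat_square)
    then show ?thesis
      by (simp only: index_transpose_mult_shift_square[OF X that] index_shift_square_mult[OF X that])
  qed
  then show ?thesis
    using dims by (auto simp: mat_eq_iff)
qed

section \<open>From entries to 2x2 blocks\<close>

lemma all_less_double_iff:
  "(\<forall>i < 2 * m. R i) \<longleftrightarrow> (\<forall>P < m. \<forall>a < 2. R (2 * P + a))" for m :: nat
proof (intro iffI allI impI)
  fix i assume "\<forall>P < m. \<forall>a < 2. R (2 * P + a)" "i < 2 * m"
  moreover have "i div 2 < m" "i mod 2 < 2"
    using \<open>i < 2 * m\<close> by auto
  ultimately have "R (2 * (i div 2) + i mod 2)"
    by blast
  then show "R i" by simp
qed auto

text \<open>A shift by 2 keeps the position inside a block, and since \<open>n\<close> is even both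
  range conditions depend on the block indices alone. The first term has \<open>b\<close> before
  \<open>a\<close> because of the transpose.\<close>

lemma block_equation_iff:
  fixes X :: "'a::monoid_add mat"
  assumes "n = 2 * m"
  shows "(\<forall>i < n. \<forall>j < n. (if 2 \<le> j then X $$ (j - 2, i) else 0)
       + (if i + 2 < n then X $$ (i + 2, j) else 0) = 0) \<longleftrightarrow>
    (\<forall>P < m. \<forall>Q < m. \<forall>a < 2. \<forall>b < 2. (if 1 \<le> Q then X $$ (2 * (Q - 1) + b, 2 * P + a) else 0)
       + (if P + 1 < m then X $$ (2 * (P + 1) + a, 2 * Q + b) else 0) = 0)"
proof -
  have eq: "(if 2 \<le> 2 * Q + b then X $$ (2 * Q + b - 2, 2 * P + a) else 0)
       + (if 2 * P + a + 2 < 2 * m then X $$ (2 * P + a + 2, 2 * Q + b) else 0)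
     = (if 1 \<le> Q then X $$ (2 * (Q - 1) + b, 2 * P + a) else 0)
       + (if P + 1 < m then X $$ (2 * (P + 1) + a, 2 * Q + b) else 0)"
    if "a < 2" "b < 2" for P Q a b
  proof -
    have "2 \<le> 2 * Q + b \<longleftrightarrow> 1 \<le> Q" "2 * P + a + 2 < 2 * m \<longleftrightarrow> P + 1 < m"
      using that by auto
    moreover have "2 * Q + b - 2 = 2 * (Q - 1) + b" if "1 \<le> Q"
      using that by simp
    moreover have "2 * P + a + 2 = 2 * (P + 1) + a" by simp
    ultimately show ?thesis by (simp only: cong: if_cong)
  qed
  show ?thesis
    unfolding assms all_less_double_iff by (simp only: eq cong: imp_cong) blast
qed

section \<open>The block equation and its solutions\<close>

text \<open>\<open>y P Q a b\<close> is the entry \<open>(a, b)\<close> of block \<open>(P, Q)\<close>; swapping the last two arguments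
  transposes a block.\<close>

lemma block_equation_solution:
  fixes y :: "nat \<Rightarrow> nat \<Rightarrow> nat \<Rightarrow> nat \<Rightarrow> 'a::ab_group_add"
  assumes "even m"
    and eq: "\<And>P Q a b. P < m \<Longrightarrow> Q < m \<Longrightarrow> a < 2 \<Longrightarrow> b < 2 \<Longrightarrow>
      (if 1 \<le> Q then y (Q - 1) P b a else 0) + (if P + 1 < m then y (P + 1) Q a b else 0) = 0"
    and PQ: "P < m" "Q < m" and ab: "a < 2" "b < 2"
  shows "y P Q a b = (if even P \<and> even Q \<and> P \<le> Q then y 0 (Q - P) a b
    else if odd P \<and> odd Q \<and> Q \<le> P then - y 0 (P - Q) b a else 0)"
proof -
  \<comment> \<open>At either end of the matrix one summand is absent: \<open>Q = 0\<close> in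
    \<open>eq\<close> gives the zeros of block-column 0, \<open>P = m - 1\<close> those of the last
    block-column.\<close>
  have first: "y P 0 a b = 0" if "0 < P" "P < m" "a < 2" "b < 2" for P a b
    using eq[of "P - 1" 0 a b] that by auto
  have last: "y P (m - 1) a b = 0" if "P + 1 < m" "a < 2" "b < 2" for P a b
    using eq[of "m - 1" "P + 1" b a] that by auto
  have swap: "y P Q a b = - y (Q - 1) (P - 1) b a"
    if "0 < P" "P < m" "0 < Q" "Q < m" "a < 2" "b < 2" for P Q a b
    using eq[of "P - 1" Q a b] that by (auto simp: add_eq_0_iff)
  have step: "y (P + 2) (Q + 2) a b = y P Q a b"
    if "P + 2 < m" "Q + 2 < m" "a < 2" "b < 2" for P Q a b
    using that swap[of "P + 2" "Q + 2" a b] swap[of "Q + 1" "P + 1" b a] by simp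
  have diag: "y (P + 2 * k) (Q + 2 * k) a b = y P Q a b"
    if "P + 2 * k < m" "Q + 2 * k < m" "a < 2" "b < 2" for P Q k a b
    using that
  proof (induction k)
    case (Suc k)
    then show ?case using step[of "P + 2 * k" "Q + 2 * k" a b] by simp
  qed simp
  \<comment> \<open>Going back \<open>Q div 2\<close> double steps along the diagonal reaches block
    \<open>(P - Q, 0)\<close>, which vanishes by \<open>first\<close>.\<close>
  have even_col: "y P Q a b = 0" if "even Q" "Q < P" "P < m" "a < 2" "b < 2" for P Q a b
    using that diag[of "P - Q" "Q div 2" 0 a b] first[of "P - Q" a b] by simp
  have odd_col: "y P Q a b = 0" if "odd Q" "P < Q" "Q < m" "a < 2" "b < 2" for P Q a b
  proof -
    \<comment> \<open>As \<open>m\<close> is even and \<open>Q\<close> odd, double steps land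
      exactly on the last block-column. By \<open>P < Q\<close> they arrive above its bottom block,
      where \<open>last\<close> applies.\<close>
    have *: "2 * ((m - 1 - Q) div 2) = m - 1 - Q"
      using that \<open>even m\<close> by simp
    show ?thesis
      using that diag[of P "(m - 1 - Q) div 2" Q a b] last[of "P + (m - 1 - Q)" a b]
      unfolding * by simp
  qed
  have upper: "y P Q a b = y 0 (Q - P) a b"
    if "even P" "P \<le> Q" "Q < m" "a < 2" "b < 2" for P Q a b
    using that diag[of 0 "P div 2" "Q - P" a b] by simp
  have pos: "0 < P" if "odd P" for P :: nat
    using that by (rule odd_pos)
  \<comment> \<open>\<open>swap\<close> sends \<open>(P, Q)\<close> to
    \<open>(Q - 1, P - 1)\<close>, a reflection in the diagonal combined with a change of both
    parities. Blocks outside the reach of \<open>even_col\<close>, \<open>odd_col\<close> and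
    \<open>upper\<close> are first moved into it this way.\<close>
  show ?thesis
  proof (cases "P \<le> Q")
    case True
    consider "odd P" "even Q" | "even P" "even Q" | "odd Q" "P < Q" | "odd P" "P = Q"
      using True by (cases "P = Q") (auto simp: less_le)
    then show ?thesis
    proof cases
      case 1
      then have "P < Q" using True by (metis le_neq_implies_less)
      then show ?thesis
        using 1 PQ ab pos[of P] swap[of P Q a b] even_col[of "P - 1" "Q - 1" b a] by simp
    next
      case 2
      then show ?thesis using True PQ ab upper[of P Q a b] by simp
    next
      case 3
      then show ?thesis using PQ ab odd_col[of Q P a b] by simp
    next
      case 4
      then show ?thesis
        using PQ ab pos[of P] swap[of P Q a b] upper[of "Q - 1" "P - 1" b a] by simp
    qed
  next
    case False
    show ?thesis
    proof (cases "even Q")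
      case True
      then show ?thesis using False PQ ab even_col[of Q P a b] by simp
    next
      case odd: False
      then show ?thesis
        using False PQ ab pos[of Q] swap[of P Q a b] upper[of "Q - 1" "P - 1" b a]
          odd_col[of "P - 1" "Q - 1" b a] by (cases "even P") simp_all
    qed
  qed
qed

text \<open>Block \<open>(Q - 1, P)\<close> is of the \<open>z\<close> type exactly when
  \<open>(P + 1, Q)\<close> is of the negated transposed type, and vice versa, with the same index
  of \<open>z\<close>; so the two summands cancel. A summand left alone at the boundary is zero; in
  the last block-row this uses that \<open>m - 1\<close> is odd.\<close>

lemma block_equation_if_form:
  fixes y :: "nat \<Rightarrow> nat \<Rightarrow> nat \<Rightarrow> nat \<Rightarrow> 'a::ab_group_add"
  assumes "even m"
    and form: "\<And>P Q a b. P < m \<Longrightarrow> Q < m \<Longrightarrow> a < 2 \<Longrightarrow> b < 2 \<Longrightarrow>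
      y P Q a b = (if even P \<and> even Q \<and> P \<le> Q then z ((Q - P) div 2) a b
        else if odd P \<and> odd Q \<and> Q \<le> P then - z ((P - Q) div 2) b a else 0)"
    and PQ: "P < m" "Q < m" and ab: "a < 2" "b < 2"
  shows "(if 1 \<le> Q then y (Q - 1) P b a else 0) + (if P + 1 < m then y (P + 1) Q a b else 0) = 0"
proof (cases Q)
  case 0
  then show ?thesis using form[of "P + 1" Q a b] PQ ab by auto
next
  case (Suc R)
  show ?thesis
  proof (cases "P + 1 < m")
    case True
    then show ?thesis using Suc form[of "P + 1" Q a b] form[of R P b a] PQ ab by auto
  next
    case False
    then have "m = Suc P" using PQ by simp
    then show ?thesis using Suc form[of R P b a] PQ ab \<open>even m\<close> by auto
  qed
qed

section \<open>Block indices starting at 1, and the theorem\<close>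

lemma all_atLeast_one_atMost_iff:
  "(\<forall>p \<in> {1..m}. R p) \<longleftrightarrow> (\<forall>P < m. R (Suc P))" for m :: nat
  unfolding image_Suc_lessThan[symmetric] by auto

text \<open>Passing from indices starting at 1 to indices starting at 0 exchanges odd and even and
  leaves differences unchanged.\<close>

lemma all_block2_eq_iff:
  fixes X :: "'a::group_add mat"
  assumes m: "even m" and Z: "\<And>k. k \<le> (m - 2) div 2 \<Longrightarrow> Z k \<in> carrier_mat 2 2"
  shows "(\<forall>p \<in> {1..m}. \<forall>q \<in> {1..m}. block2 X p q =
      (if odd p \<and> odd q \<and> p \<le> q then Z ((q - p) div 2)
       else if even p \<and> even q \<and> p \<ge> q then - transpose_mat (Z ((p - q) div 2))
       else 0\<^sub>m 2 2)) \<longleftrightarrow>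
    (\<forall>P < m. \<forall>Q < m. \<forall>a < 2. \<forall>b < 2. X $$ (2 * P + a, 2 * Q + b) =
      (if even P \<and> even Q \<and> P \<le> Q then Z ((Q - P) div 2) $$ (a, b)
       else if odd P \<and> odd Q \<and> Q \<le> P then - (Z ((P - Q) div 2) $$ (b, a)) else 0))"
proof -
  have "block2 X (Suc P) (Suc Q) =
      (if even P \<and> even Q \<and> P \<le> Q then Z ((Q - P) div 2)
       else if odd P \<and> odd Q \<and> Q \<le> P then - transpose_mat (Z ((P - Q) div 2))
       else 0\<^sub>m 2 2) \<longleftrightarrow>
    (\<forall>a < 2. \<forall>b < 2. X $$ (2 * P + a, 2 * Q + b) =
      (if even P \<and> even Q \<and> P \<le> Q then Z ((Q - P) div 2) $$ (a, b)
       else if odd P \<and> odd Q \<and> Q \<le> P then - (Z ((P - Q) div 2) $$ (b, a)) else 0))"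
    if PQ: "P < m" "Q < m" for P Q
  proof -
    consider (upper) "even P" "even Q" "P \<le> Q" | (lower) "odd P" "odd Q" "Q \<le> P"
      | (zero) "\<not> (even P \<and> even Q \<and> P \<le> Q)" "\<not> (odd P \<and> odd Q \<and> Q \<le> P)"
      by blast
    then show ?thesis
    proof cases
      case upper
      \<comment> \<open>Two indices of equal parity below the even number \<open>m\<close> differ by
        at most \<open>m - 2\<close>, so the index of \<open>Z\<close> stays in the range where its
        dimensions are known.\<close>
      then have "Q - P \<le> m - 2" using PQ m by presburger
      then have "Z ((Q - P) div 2) \<in> carrier_mat 2 2" by (intro Z div_le_mono)
      then show ?thesis using upper by (auto simp: block2_def mat_eq_iff)
    next
      case lower
      then have "P - Q \<le> m - 2" using PQ by presburger
      then have "Z ((P - Q) div 2) \<in> carrier_mat 2 2" by (intro Z div_le_mono)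
      then show ?thesis using lower by (auto simp: block2_def mat_eq_iff)
    next
      case zero
      then show ?thesis using zero by (auto simp: block2_def mat_eq_iff)
    qed
  qed
  then show ?thesis
    unfolding all_atLeast_one_atMost_iff by (simp cong: if_cong)
qed

theorem proposition5p1:
  fixes n m :: nat
  assumes "n mod 4 = 0" and "n \<ge> 4" and "m = n div 2"
  shows "{X \<in> carrier_mat n n.
            transpose_mat X * (shift_mat n ^\<^sub>m 2) + (shift_mat n ^\<^sub>m 2) * X = 0\<^sub>m n n} =
         {X \<in> carrier_mat n n.
            \<exists>Z :: nat \<Rightarrow> complex mat. (\<forall>k \<le> (n - 4) div 4. Z k \<in> carrier_mat 2 2) \<and>
              (\<forall>p \<in> {1..m}. \<forall>q \<in> {1..m}.
                 block2 X p q =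
                   (if odd p \<and> odd q \<and> p \<le> q then Z ((q - p) div 2)
                    else if even p \<and> even q \<and> p \<ge> q then - transpose_mat (Z ((p - q) div 2))
                    else 0\<^sub>m 2 2))}"
proof (rule Collect_cong, rule conj_cong[OF refl])
  fix X :: "complex mat" assume X: "X \<in> carrier_mat n n"
  from \<open>n mod 4 = 0\<close> obtain k where "n = 4 * k" by (auto simp: mod_eq_0_iff_dvd)
  then have n: "n = 2 * m" and m: "even m" and bound: "(n - 4) div 4 = (m - 2) div 2"
    using \<open>m = n div 2\<close> by auto
  let ?y = "\<lambda>P Q a b. X $$ (2 * P + a, 2 * Q + b)"
  let ?eq = "\<forall>P < m. \<forall>Q < m. \<forall>a < 2. \<forall>b < 2.
    (if 1 \<le> Q then ?y (Q - 1) P b a else 0) + (if P + 1 < m then ?y (P + 1) Q a b else 0) = 0"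
  let ?form = "\<lambda>Z. \<forall>p \<in> {1..m}. \<forall>q \<in> {1..m}. block2 X p q =
    (if odd p \<and> odd q \<and> p \<le> q then Z ((q - p) div 2)
     else if even p \<and> even q \<and> p \<ge> q then - transpose_mat (Z ((p - q) div 2)) else 0\<^sub>m 2 2)"
  have "?eq \<longleftrightarrow> (\<exists>Z. (\<forall>k \<le> (n - 4) div 4. Z k \<in> carrier_mat 2 2) \<and> ?form Z)"
  proof
    assume eq: ?eq
    \<comment> \<open>This choice is forced by the prescribed form at \<open>p = 1\<close>,
      \<open>q = 2 * k + 1\<close>. \<open>block2\<close> always returns a 2x2 matrix, so the
      dimension condition holds for every \<open>k\<close>.\<close>
    define Z where "Z k = block2 X 1 (2 * k + 1)" for k
    have Z: "Z k \<in> carrier_mat 2 2" for k by (simp add: Z_def block2_def)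
    have Z_index: "Z k $$ (a, b) = ?y 0 (2 * k) a b" if "a < 2" "b < 2" for k a b
      using that by (simp add: Z_def block2_def)
    have "?y P Q a b = (if even P \<and> even Q \<and> P \<le> Q then Z ((Q - P) div 2) $$ (a, b)
       else if odd P \<and> odd Q \<and> Q \<le> P then - (Z ((P - Q) div 2) $$ (b, a)) else 0)"
      if "P < m" "Q < m" "a < 2" "b < 2" for P Q a b
      using block_equation_solution[of m ?y P Q a b] eq m that
      by (simp add: Z_index cong: if_cong)
    then have "?form Z"
      by (subst all_block2_eq_iff[OF m]) (use Z in auto)
    then show "\<exists>Z. (\<forall>k \<le> (n - 4) div 4. Z k \<in> carrier_mat 2 2) \<and> ?form Z"
      using Z by blast
  next
    assume "\<exists>Z. (\<forall>k \<le> (n - 4) div 4. Z k \<in> carrier_mat 2 2) \<and> ?form Z"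
    then obtain Z where Z: "\<And>k. k \<le> (m - 2) div 2 \<Longrightarrow> Z k \<in> carrier_mat 2 2" and "?form Z"
      unfolding bound by blast
    then have "\<forall>P < m. \<forall>Q < m. \<forall>a < 2. \<forall>b < 2. ?y P Q a b =
      (if even P \<and> even Q \<and> P \<le> Q then Z ((Q - P) div 2) $$ (a, b)
       else if odd P \<and> odd Q \<and> Q \<le> P then - (Z ((P - Q) div 2) $$ (b, a)) else 0)"
      using all_block2_eq_iff[of m Z X] m by blast
    then show ?eq
      using block_equation_if_form[OF m, of ?y "\<lambda>k a b. Z k $$ (a, b)"] by blast
  qed
  then show "transpose_mat X * (shift_mat n ^\<^sub>m 2) + (shift_mat n ^\<^sub>m 2) * X = 0\<^sub>m n n \<longleftrightarrow>
      (\<exists>Z. (\<forall>k \<le> (n - 4) div 4. Z k \<in> carrier_mat 2 2) \<and> ?form Z)"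
    unfolding shift_square_equation_iff[OF X] block_equation_iff[OF n] .
qed

end
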